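(* Let $0<\lambda\le 1$ and let $f_1,f_2\in\Omega_{\mathcal{H}}^0(\lambda)$. Then $f_1\ast f_2\in\Omega_{\mathcal{H}}^0(\lambda)$.
   Context: $\mathbb{D}=\{z\in\mathbb{C}:|z|<1\}$. $\mathcal{H}^0$ is the class of complex-valued harmonic functions $f=h+\overline{g}$ on $\mathbb{D}$, where $h,g$ are analytic on $\mathbb{D}$ with $h(z)=z+\sum_{n\ge2}a_nz^n$ and $g(z)=\sum_{n\ge2}b_nz^n$. For $\lambda>0$, $\Omega_{\mathcal{H}}^0(\lambda)$ is the set of $f=h+\overline{g}\in\mathcal{H}^0$ such that $|h(z)-zh'(z)|<\lambda-|g(z)-zg'(z)|$ for all $z\in\mathbb{D}$. The convolution (Hadamard product) of analytic functions $F_1(z)=\sum_{n\ge0}a_nz^n$ and $F_2(z)=\sum_{n\ge0}b_nz^n$ is $(F_1\ast F_2)(z)=\sum_{n\ge0}a_nb_nz^n$; the convolution of harmonic functions $f_1=h_1+\overline{g_1}$ and $f_2=h_2+\overline{g_2}$ is $f_1\ast f_2=(h_1\ast h_2)+\overline{(g_1\ast g_2)}$. *)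

theory Defs
  imports "HOL-Complex_Analysis.Complex_Analysis"
begin

abbreviation unit_disc :: "complex set" where
  "unit_disc \<equiv> ball 0 1"

text \<open>
  Functions on the unit disc are total functions whose values off the disc are irrelevant.
  The representation \<open>f = h + cnj g\<close> of a harmonic function is unique on the disc once
  \<open>g 0 = 0\<close> is imposed (\<open>harmonic_rep_unique\<close> below); for the class \<open>harmonic0\<close> this
  normalisation is automatic.
\<close>

definition harmonic_rep ::
    "(complex \<Rightarrow> complex) \<Rightarrow> (complex \<Rightarrow> complex) \<Rightarrow> (complex \<Rightarrow> complex) \<Rightarrow> bool" where
  "harmonic_rep f h g \<longleftrightarrow>
     h holomorphic_on unit_disc \<and> g holomorphic_on unit_disc \<and> g 0 = 0 \<and>
     (\<forall>z\<in>unit_disc. f z = h z + cnj (g z))"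

definition harmonic0_rep ::
    "(complex \<Rightarrow> complex) \<Rightarrow> (complex \<Rightarrow> complex) \<Rightarrow> (complex \<Rightarrow> complex) \<Rightarrow> bool" where
  "harmonic0_rep f h g \<longleftrightarrow> harmonic_rep f h g \<and>
     fps_nth (fps_expansion h 0) 0 = 0 \<and> fps_nth (fps_expansion h 0) 1 = 1 \<and>
     fps_nth (fps_expansion g 0) 0 = 0 \<and> fps_nth (fps_expansion g 0) 1 = 0"

definition harmonic0 :: "(complex \<Rightarrow> complex) set" where
  "harmonic0 = {f. \<exists>h g. harmonic0_rep f h g}"

definition Omega_harmonic0 :: "real \<Rightarrow> (complex \<Rightarrow> complex) set" where
  "Omega_harmonic0 lam = {f \<in> harmonic0. \<exists>h g. harmonic0_rep f h g \<and>
     (\<forall>z\<in>unit_disc. norm (h z - z * deriv h z) < lam - norm (g z - z * deriv g z))}"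

definition analytic_conv :: "(complex \<Rightarrow> complex) \<Rightarrow> (complex \<Rightarrow> complex) \<Rightarrow> complex \<Rightarrow> complex" where
  "analytic_conv F\<^sub>1 F\<^sub>2 z =
     (\<Sum>n. fps_nth (fps_expansion F\<^sub>1 0) n * fps_nth (fps_expansion F\<^sub>2 0) n * z ^ n)"

text \<open>
  The choice only matters off the disc, which does not affect Taylor coefficients at \<open>0\<close>;
  see \<open>harmonic_conv_eq\<close>.
\<close>

definition harmonic_parts :: "(complex \<Rightarrow> complex) \<Rightarrow> (complex \<Rightarrow> complex) \<times> (complex \<Rightarrow> complex)" where
  "harmonic_parts f = (SOME (h, g). harmonic_rep f h g)"

definition harmonic_conv :: "(complex \<Rightarrow> complex) \<Rightarrow> (complex \<Rightarrow> complex) \<Rightarrow> complex \<Rightarrow> complex" where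
  "harmonic_conv f\<^sub>1 f\<^sub>2 z =
     (let (h\<^sub>1, g\<^sub>1) = harmonic_parts f\<^sub>1; (h\<^sub>2, g\<^sub>2) = harmonic_parts f\<^sub>2
      in analytic_conv h\<^sub>1 h\<^sub>2 z + cnj (analytic_conv g\<^sub>1 g\<^sub>2 z))"

lemma holomorphic_real_on_disc_constant:
  assumes "f holomorphic_on unit_disc" and im: "\<And>z. z \<in> unit_disc \<Longrightarrow> Im (f z) = 0"
    and z: "z \<in> unit_disc"
  shows "f z = f 0"
proof (cases "f constant_on unit_disc")
  case True
  then show ?thesis using z by (auto simp: constant_on_def)
next
  case False
  then have "open (f ` unit_disc)"
    using assms by (intro open_mapping_thm[of f unit_disc]) auto
  then obtain e where e: "e > 0" "ball (f 0) e \<subseteq> f ` unit_disc"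
    by (meson centre_in_ball image_eqI openE zero_less_one)
  have "f 0 + \<i> * of_real (e / 2) \<in> ball (f 0) e"
    using e(1) by (simp add: dist_norm norm_mult)
  then obtain w where "w \<in> unit_disc" "f w = f 0 + \<i> * of_real (e / 2)"
    using e(2) by (metis imageE subsetD)
  then have "Im (f 0 + \<i> * of_real (e / 2)) = 0"
    using im by metis
  then show ?thesis using im[of 0] e(1) by simp
qed

lemma harmonic_rep_unique:
  assumes 1: "harmonic_rep f h g" and 2: "harmonic_rep f h' g'" and z: "z \<in> unit_disc"
  shows "h z = h' z" "g z = g' z"
proof -
  define H where "H = (\<lambda>z. h z - h' z)"
  define K where "K = (\<lambda>z. g' z - g z)"
  have hol: "H holomorphic_on unit_disc" "K holomorphic_on unit_disc"
    using 1 2 by (auto simp: H_def K_def harmonic_rep_def intro!: holomorphic_intros)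
  have HK: "H w = cnj (K w)" if "w \<in> unit_disc" for w
  proof -
    have "h w + cnj (g w) = h' w + cnj (g' w)"
      using 1 2 that unfolding harmonic_rep_def by metis
    then show ?thesis by (simp add: H_def K_def algebra_simps)
  qed
  have K0: "K 0 = 0" using 1 2 by (simp add: K_def harmonic_rep_def)
  then have H0: "H 0 = 0" using HK[of 0] by simp
  have a: "H z + K z = H 0 + K 0"
    using hol HK z by (intro holomorphic_real_on_disc_constant[of "\<lambda>z. H z + K z"])
      (auto intro!: holomorphic_intros)
  have b: "\<i> * (H z - K z) = \<i> * (H 0 - K 0)"
    using hol HK z by (intro holomorphic_real_on_disc_constant[of "\<lambda>z. \<i> * (H z - K z)"])
      (auto intro!: holomorphic_intros)
  from b have b': "H z = K z" using K0 H0 by simp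
  have "K z = 0" using a K0 H0 unfolding b' by simp
  then show "h z = h' z" "g z = g' z" using b' by (auto simp: H_def K_def)
qed

lemma fps_expansion_cong_disc:
  assumes "\<And>z. z \<in> unit_disc \<Longrightarrow> F z = G z"
  shows "fps_expansion F 0 = fps_expansion G 0"
proof -
  have "\<forall>\<^sub>F z in nhds 0. F z = G z"
    using assms by (intro eventually_nhds_in_open[THEN eventually_mono, of unit_disc]) auto
  then show ?thesis
    unfolding fps_expansion_def by (metis higher_deriv_cong_ev)
qed

lemma harmonic_conv_eq:
  assumes 1: "harmonic_rep f\<^sub>1 h\<^sub>1 g\<^sub>1" and 2: "harmonic_rep f\<^sub>2 h\<^sub>2 g\<^sub>2"
  shows "harmonic_conv f\<^sub>1 f\<^sub>2 z = analytic_conv h\<^sub>1 h\<^sub>2 z + cnj (analytic_conv g\<^sub>1 g\<^sub>2 z)"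
proof -
  have parts: "fps_expansion (fst (harmonic_parts f)) 0 = fps_expansion h 0 \<and>
      fps_expansion (snd (harmonic_parts f)) 0 = fps_expansion g 0"
    if "harmonic_rep f h g" for f h g
  proof -
    have "case harmonic_parts f of (h, g) \<Rightarrow> harmonic_rep f h g"
      unfolding harmonic_parts_def by (rule someI[of _ "(h, g)"]) (use that in simp)
    then have "harmonic_rep f (fst (harmonic_parts f)) (snd (harmonic_parts f))"
      by (simp add: case_prod_beta)
    from harmonic_rep_unique[OF this that] show ?thesis
      by (auto intro!: fps_expansion_cong_disc)
  qed
  show ?thesis
    using parts[OF 1] parts[OF 2]
    by (simp add: harmonic_conv_def analytic_conv_def case_prod_beta Let_def)
qed

end

theory Submission
  imports Defs
begin

text \<open>
  Writing \<open>a\<^sub>n\<close>, \<open>b\<^sub>n\<close> for the coefficients of \<open>h\<close>, \<open>g\<close>, the functions \<open>h - z h'\<close> and \<open>g - z g'\<close>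
  have coefficients \<open>(1 - n) a\<^sub>n\<close> and \<open>(1 - n) b\<^sub>n\<close>, so Parseval's identity turns membership in the
  class into \<open>\<Sum> (n - 1)\<^sup>2 (\<bar>a\<^sub>n\<bar>\<^sup>2 + \<bar>b\<^sub>n\<bar>\<^sup>2) \<le> \<lambda>\<^sup>2\<close>. For the convolution, the left-hand side of the
  defining inequality is at most
  \<open>\<Sum> (n - 1) (\<bar>a\<^sub>n a'\<^sub>n\<bar> + \<bar>b\<^sub>n b'\<^sub>n\<bar>) \<bar>z\<bar>\<^sup>n\<close>; since \<open>n - 1 \<le> (n - 1)\<^sup>2\<close>, AM-GM bounds this by
  \<open>\<lambda>\<^sup>2 \<bar>z\<bar>\<close>, which is less than \<open>\<lambda>\<close> when \<open>\<lambda> \<le> 1\<close>.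
\<close>

section \<open>Finite Parseval identity and the resulting bound on circles\<close>

text \<open>The characters \<open>k \<mapsto> \<omega> N k ^ n\<close> with \<open>n < N\<close> are
  orthogonal on the integers mod \<open>N\<close>. Sampling at the \<open>N\<close>-th roots of
  unity replaces the integral mean over the circle and is exact for polynomials of degree below
  \<open>N\<close>.\<close>

lemma parseval_roots_of_unity:
  fixes c :: "nat \<Rightarrow> complex"
  defines "\<omega> N k \<equiv> cis (2 * pi * real k / real N)"
  shows "(\<Sum>k<N. (norm (\<Sum>n<N. c n * \<omega> N k ^ n))\<^sup>2) = real N * (\<Sum>n<N. (norm (c n))\<^sup>2)"
proof (cases "N = 0")
  case False
  \<comment> \<open>Exchanging \<open>k\<close> and \<open>n\<close> makes the character a power in
    \<open>k\<close>, so the sum in \<open>orth\<close> becomes geometric with ratio an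
    \<open>N\<close>-th root of unity.\<close>
  have pow: "\<omega> N k ^ n = \<omega> N n ^ k" for k n
    unfolding \<omega>_def Complex.DeMoivre by (simp add: mult_ac)
  have orth: "(\<Sum>k<N. \<omega> N k ^ n * cnj (\<omega> N k ^ m)) = (if n = m then of_nat N else 0)"
    if "n < N" "m < N" for n m
  proof -
    define q where "q = \<omega> N n * cnj (\<omega> N m)"
    have unit: "\<omega> N m * cnj (\<omega> N m) = 1"
      by (simp add: \<omega>_def cis_cnj cis_mult)
    have sum: "(\<Sum>k<N. \<omega> N k ^ n * cnj (\<omega> N k ^ m)) = (\<Sum>k<N. q ^ k)"
      by (simp add: pow[of _ n] pow[of _ m] q_def power_mult_distrib)
    show ?thesis
    proof (cases "n = m")
      case True
      then show ?thesis using sum unit by (simp add: q_def)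
    next
      case False
      have "\<omega> N n ^ N = 1" "\<omega> N m ^ N = 1"
        using pow[of n N] pow[of m N] \<open>N \<noteq> 0\<close> by (simp_all add: \<omega>_def)
      then have "q ^ N = 1"
        by (simp add: q_def power_mult_distrib flip: complex_cnj_power)
      moreover have "q \<noteq> 1"
      proof
        assume "q = 1"
        then have "\<omega> N n = \<omega> N m"
          using unit unfolding q_def by (metis mult_right_cancel mult_zero_right zero_neq_one)
        then show False
          using inj_onD[OF bij_betw_imp_inj_on[OF Complex.bij_betw_roots_unity[of N]], of n m]
            that \<open>N \<noteq> 0\<close> \<open>n \<noteq> m\<close>
          by (auto simp: \<omega>_def)
      qed
      ultimately show ?thesis
        using sum False by (simp add: geometric_sum)
    qed
  qed
  have "complex_of_real (\<Sum>k<N. (norm (\<Sum>n<N. c n * \<omega> N k ^ n))\<^sup>2) =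
      (\<Sum>k<N. \<Sum>n<N. \<Sum>m<N. c n * cnj (c m) * (\<omega> N k ^ n * cnj (\<omega> N k ^ m)))"
    by (simp add: complex_norm_square sum_product mult_ac flip: of_real_power)
  also have "\<dots> = (\<Sum>n<N. \<Sum>m<N. c n * cnj (c m) * (\<Sum>k<N. \<omega> N k ^ n * cnj (\<omega> N k ^ m)))"
    unfolding sum_distrib_left
    by (rule trans[OF sum.swap], rule sum.cong[OF refl], rule sum.swap)
  also have "\<dots> = (\<Sum>n<N. \<Sum>m<N. if n = m then c n * cnj (c m) * of_nat N else 0)"
    by (intro sum.cong refl) (use orth in auto)
  also have "\<dots> = complex_of_real (real N * (\<Sum>n<N. (norm (c n))\<^sup>2))"
    by (simp add: complex_norm_square sum_distrib_left mult_ac flip: of_real_power)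
  finally show ?thesis
    using of_real_eq_iff by blast
qed simp

text \<open>The finite Parseval identity is applied to the coefficients scaled by
  \<open>r ^ n\<close>, that is, to samples on the circle of radius \<open>r\<close>. Two
  nonnegative reals satisfy x^2 + y^2 \<le> (x + y)^2, so the bound on the sum of the norms controls
  both families at once.\<close>

lemma parseval_bound_circle:
  fixes c d :: "nat \<Rightarrow> complex"
  assumes "\<And>z. norm z = r \<Longrightarrow> norm (\<Sum>n<N. c n * z ^ n) + norm (\<Sum>n<N. d n * z ^ n) \<le> B"
    and "0 \<le> r"
  shows "(\<Sum>n<N. ((norm (c n))\<^sup>2 + (norm (d n))\<^sup>2) * (r ^ n)\<^sup>2) \<le> B\<^sup>2"
proof (cases "N = 0")
  case False
  define \<omega> where "\<omega> k = cis (2 * pi * real k / real N)" for k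
  define S where "S c k = (\<Sum>n<N. c n * of_real (r ^ n) * \<omega> k ^ n)" for c :: "nat \<Rightarrow> complex" and k
  have S: "(\<Sum>k<N. (norm (S c k))\<^sup>2) = real N * (\<Sum>n<N. (norm (c n))\<^sup>2 * (r ^ n)\<^sup>2)" for c
    using parseval_roots_of_unity[where c = "\<lambda>n. c n * of_real (r ^ n)" and N = N]
      \<open>0 \<le> r\<close>
    by (simp add: S_def \<omega>_def norm_mult norm_power power_mult_distrib)
  have "(norm (S c k))\<^sup>2 + (norm (S d k))\<^sup>2 \<le> B\<^sup>2" for k
  proof -
    have "norm (of_real r * \<omega> k) = r"
      using \<open>0 \<le> r\<close> by (simp add: norm_mult \<omega>_def)
    then have "norm (S c k) + norm (S d k) \<le> B"
      using assms(1)[of "of_real r * \<omega> k"] by (simp add: S_def power_mult_distrib mult_ac)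
    then have "(norm (S c k) + norm (S d k))\<^sup>2 \<le> B\<^sup>2"
      by (intro power_mono) auto
    moreover have "0 \<le> norm (S c k) * norm (S d k)"
      by simp
    ultimately show ?thesis
      unfolding power2_sum by linarith
  qed
  then have "(\<Sum>k<N. (norm (S c k))\<^sup>2 + (norm (S d k))\<^sup>2) \<le> (\<Sum>k<N. B\<^sup>2)"
    by (intro sum_mono)
  then have "real N * (\<Sum>n<N. ((norm (c n))\<^sup>2 + (norm (d n))\<^sup>2) * (r ^ n)\<^sup>2) \<le> real N * B\<^sup>2"
    by (simp add: sum.distrib S distrib_right distrib_left)
  then show ?thesis
    using False by simp
qed simp

section \<open>Taylor series on the unit disc and Parseval's inequality\<close>

lemma fps_conv_radius_expansion_disc:
  assumes "F holomorphic_on unit_disc"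
  shows "fps_conv_radius (fps_expansion F 0) \<ge> 1"
  using conv_radius_fps_expansion[of F 0 1] assms by (simp add: one_ereal_def)

lemma has_fps_expansion_disc:
  assumes "F holomorphic_on unit_disc"
  shows "F has_fps_expansion fps_expansion F 0"
  using has_fps_expansion_fps_expansion[of unit_disc F] assms by simp

lemma fps_expansion_sums_disc:
  assumes "F holomorphic_on unit_disc" "z \<in> unit_disc"
  shows "(\<lambda>n. fps_nth (fps_expansion F 0) n * z ^ n) sums F z"
  using has_fps_expansion_imp_sums_complex[OF has_fps_expansion_disc, of F 1 z] assms
  by (simp add: one_ereal_def)

text \<open>The circle bound is applied to Taylor polynomials, which approximate \<open>F\<close>
  and \<open>G\<close> uniformly on smaller discs. The number \<open>m\<close> of coefficients stays
  fixed while the error \<open>\<delta>\<close> tends to 0 and then the radius \<open>r\<close>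
  tends to 1.\<close>

lemma parseval_bound_disc:
  assumes F: "F holomorphic_on unit_disc" and G: "G holomorphic_on unit_disc"
    and le: "\<And>z. z \<in> unit_disc \<Longrightarrow> norm (F z) + norm (G z) \<le> B"
  shows "(\<Sum>n<m. (norm (fps_nth (fps_expansion F 0) n))\<^sup>2 +
                  (norm (fps_nth (fps_expansion G 0) n))\<^sup>2) \<le> B\<^sup>2"
proof -
  define c where "c = fps_nth (fps_expansion F 0)"
  define d where "d = fps_nth (fps_expansion G 0)"
  have approx: "\<forall>\<^sub>F N in sequentially. \<forall>z\<in>cball 0 r. 
      norm (\<Sum>n<N. fps_nth (fps_expansion H 0) n * z ^ n) \<le> norm (H z) + \<delta>"
    if H: "H holomorphic_on unit_disc" and r: "r < 1" and \<delta>: "\<delta> > 0" for H r and \<delta> :: real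
  proof -
    have "ereal r < conv_radius (fps_nth (fps_expansion H 0))"
      using fps_conv_radius_expansion_disc[OF H] r unfolding fps_conv_radius_def
      by (metis ereal_less(3) less_le_trans)
    then have "uniform_limit (cball 0 r) (\<lambda>N z. \<Sum>n<N. fps_nth (fps_expansion H 0) n * (z - 0) ^ n)
        (\<lambda>z. suminf (\<lambda>n. fps_nth (fps_expansion H 0) n * (z - 0) ^ n)) sequentially"
      by (rule powser_uniform_limit)
    from uniform_limitD[OF this \<delta>] show ?thesis
    proof eventually_elim
      case (elim N)
      show ?case
      proof
        fix z :: complex assume z: "z \<in> cball 0 r"
        then have "z \<in> unit_disc" using r by auto
        then have "(\<Sum>n. fps_nth (fps_expansion H 0) n * z ^ n) = H z"
          using fps_expansion_sums_disc[OF H] by (metis sums_unique)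
        then have "dist (\<Sum>n<N. fps_nth (fps_expansion H 0) n * z ^ n) (H z) < \<delta>"
          using bspec[OF elim z] by simp
        then show "norm (\<Sum>n<N. fps_nth (fps_expansion H 0) n * z ^ n) \<le> norm (H z) + \<delta>"
          unfolding dist_norm by norm
      qed
    qed
  qed
  \<comment> \<open>The degree \<open>N\<close> depends on \<open>r\<close> and
    \<open>\<delta>\<close>; as the summands are nonnegative, the sum may be cut back to
    \<open>m \<le> N\<close>. Each of \<open>F\<close> and \<open>G\<close> contributes one
    \<open>\<delta>\<close>.\<close>
  have circle: "(\<Sum>n<m. ((norm (c n))\<^sup>2 + (norm (d n))\<^sup>2) * (r ^ n)\<^sup>2) \<le> (B + 2 * \<delta>)\<^sup>2"
    if r: "0 \<le> r" "r < 1" and \<delta>: "\<delta> > 0" for r \<delta>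
  proof -
    have "\<forall>\<^sub>F N in sequentially. N \<ge> m \<and> (\<forall>z. norm z = r \<longrightarrow>
        norm (\<Sum>n<N. c n * z ^ n) + norm (\<Sum>n<N. d n * z ^ n) \<le> B + 2 * \<delta>)"
      using approx[OF F r(2) \<delta>] approx[OF G r(2) \<delta>] eventually_ge_at_top[of m]
    proof eventually_elim
      case (elim N)
      have "norm (\<Sum>n<N. c n * z ^ n) + norm (\<Sum>n<N. d n * z ^ n) \<le> B + 2 * \<delta>"
        if "norm z = r" for z
        using elim(1)[rule_format, of z] elim(2)[rule_format, of z] le[of z] that r
        by (simp add: c_def d_def)
      with elim show ?case by blast
    qed
    from eventually_happens'[OF sequentially_bot this] obtain N where N: "N \<ge> m" "\<And>z. norm z = r \<Longrightarrow>
        norm (\<Sum>n<N. c n * z ^ n) + norm (\<Sum>n<N. d n * z ^ n) \<le> B + 2 * \<delta>"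
      by blast
    have "(\<Sum>n<m. ((norm (c n))\<^sup>2 + (norm (d n))\<^sup>2) * (r ^ n)\<^sup>2) \<le>
        (\<Sum>n<N. ((norm (c n))\<^sup>2 + (norm (d n))\<^sup>2) * (r ^ n)\<^sup>2)"
      using N(1) by (intro sum_mono2) auto
    also have "\<dots> \<le> (B + 2 * \<delta>)\<^sup>2"
      using N(2) r(1) by (rule parseval_bound_circle)
    finally show ?thesis .
  qed
  have "(\<Sum>n<m. ((norm (c n))\<^sup>2 + (norm (d n))\<^sup>2) * (r ^ n)\<^sup>2) \<le> B\<^sup>2"
    if r: "0 \<le> r" "r < 1" for r
  proof (rule tendsto_lowerbound)
    have "((\<lambda>\<delta>. (B + 2 * \<delta>)\<^sup>2) \<longlongrightarrow> (B + 2 * 0)\<^sup>2) (at_right 0)"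
      by (intro tendsto_intros)
    then show "((\<lambda>\<delta>. (B + 2 * \<delta>)\<^sup>2) \<longlongrightarrow> B\<^sup>2) (at_right 0)"
      by simp
    show "\<forall>\<^sub>F \<delta> in at_right 0. (\<Sum>n<m. ((norm (c n))\<^sup>2 + (norm (d n))\<^sup>2) * (r ^ n)\<^sup>2) \<le> (B + 2 * \<delta>)\<^sup>2"
      using eventually_at_right_less[of 0] by eventually_elim (use r circle in blast)
  qed simp
  \<comment> \<open>Only finitely many summands are left, so the bound passes to the limit
    \<open>r = 1\<close> by continuity.\<close>
  then have "\<forall>\<^sub>F r in at_left 1. (\<Sum>n<m. ((norm (c n))\<^sup>2 + (norm (d n))\<^sup>2) * (r ^ n)\<^sup>2) \<le> B\<^sup>2"
    using eventually_at_left_real[of 0 1] by (auto elim: eventually_mono)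
  moreover have "((\<lambda>r. \<Sum>n<m. ((norm (c n))\<^sup>2 + (norm (d n))\<^sup>2) * (r ^ n)\<^sup>2) \<longlongrightarrow>
      (\<Sum>n<m. ((norm (c n))\<^sup>2 + (norm (d n))\<^sup>2) * (1 ^ n)\<^sup>2)) (at_left 1)"
    by (intro tendsto_intros)
  ultimately show ?thesis
    using tendsto_upperbound[of _ _ "at_left (1::real)" "B\<^sup>2"] by (simp add: c_def d_def)
qed

section \<open>The operator F - z F' and its Taylor coefficients\<close>

lemma holomorphic_defect:
  assumes "F holomorphic_on unit_disc"
  shows "(\<lambda>z. F z - z * deriv F z) holomorphic_on unit_disc"
  using assms by (intro holomorphic_intros) auto

lemma fps_nth_defect:
  assumes "F holomorphic_on unit_disc"
  shows "fps_nth (fps_expansion (\<lambda>z. F z - z * deriv F z) 0) n =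
    (1 - of_nat n) * fps_nth (fps_expansion F 0) n"
proof -
  have "(\<lambda>z. F z - z * deriv F z) has_fps_expansion
      fps_expansion F 0 - fps_X * fps_deriv (fps_expansion F 0)"
    by (intro fps_expansion_intros has_fps_expansion_disc assms)
  then have eq: "fps_expansion (\<lambda>z. F z - z * deriv F z) 0 =
      fps_expansion F 0 - fps_X * fps_deriv (fps_expansion F 0)"
    by (rule fps_expansion_eqI)
  show ?thesis
    unfolding eq by (cases n) (simp_all add: algebra_simps)
qed

section \<open>Convolutions on the unit disc\<close>

text \<open>Writing r = s^2 with s < 1 splits the general term into \<open>a n * s ^ n\<close>,
  which is absolutely summable, and \<open>b n * s ^ n\<close>, which tends to 0 and is therefore
  eventually below 1 in norm.\<close>

lemma conv_radius_hadamard_ge: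
  fixes a b :: "nat \<Rightarrow> 'a :: {banach, real_normed_field}"
  assumes "conv_radius a \<ge> 1" "conv_radius b \<ge> 1"
  shows "conv_radius (\<lambda>n. a n * b n) \<ge> 1"
proof (rule conv_radius_geI_ex')
  fix r :: real assume "0 < r" "ereal r < 1"
  define s :: 'a where "s = of_real (sqrt r)"
  have s: "norm s < 1" "of_real r = s * s"
    using \<open>0 < r\<close> \<open>ereal r < 1\<close> by (simp_all add: s_def one_ereal_def flip: of_real_mult)
  then have "ereal (norm s) < conv_radius a" "ereal (norm s) < conv_radius b"
    using assms by (metis ereal_less(3) less_le_trans)+
  then have summable: "summable (\<lambda>n. norm (a n * s ^ n))" "summable (\<lambda>n. b n * s ^ n)"
    by (auto intro: abs_summable_in_conv_radius summable_in_conv_radius)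
  have "\<forall>\<^sub>F n in sequentially. norm (b n * s ^ n) < 1"
    using tendsto_norm[OF summable_LIMSEQ_zero[OF summable(2)]] by (intro order_tendstoD(2)) auto
  then have "\<forall>\<^sub>F n in sequentially. norm (a n * b n * of_real r ^ n) \<le> norm (a n * s ^ n)"
  proof eventually_elim
    case (elim n)
    have "a n * b n * of_real r ^ n = (a n * s ^ n) * (b n * s ^ n)"
      by (simp add: s(2) power_mult_distrib mult_ac)
    then show ?case
      using elim by (metis norm_mult less_imp_le mult_left_le norm_ge_zero)
  qed
  then show "summable (\<lambda>n. a n * b n * of_real r ^ n)"
    using summable(1) by (rule summable_comparison_test_ev)
qed

lemma
  assumes F: "F holomorphic_on unit_disc" and G: "G holomorphic_on unit_disc"
  shows holomorphic_analytic_conv: "analytic_conv F G holomorphic_on unit_disc"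
    and fps_nth_analytic_conv: "fps_nth (fps_expansion (analytic_conv F G) 0) n =
      fps_nth (fps_expansion F 0) n * fps_nth (fps_expansion G 0) n"
proof -
  define C where "C = Abs_fps (\<lambda>n. fps_nth (fps_expansion F 0) n * fps_nth (fps_expansion G 0) n)"
  \<comment> \<open>This holds at every point, even where the series diverges, because both sides
    are the same \<open>suminf\<close>.\<close>
  have eq: "analytic_conv F G = eval_fps C"
    by (intro ext) (simp add: analytic_conv_def eval_fps_def C_def)
  have C: "fps_conv_radius C \<ge> 1"
    using conv_radius_hadamard_ge[of "fps_nth (fps_expansion F 0)" "fps_nth (fps_expansion G 0)"]
      fps_conv_radius_expansion_disc[OF F] fps_conv_radius_expansion_disc[OF G]
    by (simp add: fps_conv_radius_def C_def)
  then have "unit_disc \<subseteq> eball 0 (fps_conv_radius C)"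
    by (intro ball_eball_mono) (simp add: one_ereal_def)
  then show "analytic_conv F G holomorphic_on unit_disc"
    unfolding eq by (rule holomorphic_on_eval_fps)
  have "0 < fps_conv_radius C"
    by (rule less_le_trans[OF _ C]) simp
  then have "fps_expansion (analytic_conv F G) 0 = C"
    unfolding eq by (intro fps_expansion_eqI eval_fps_has_fps_expansion)
  then show "fps_nth (fps_expansion (analytic_conv F G) 0) n =
      fps_nth (fps_expansion F 0) n * fps_nth (fps_expansion G 0) n"
    by (simp add: C_def)
qed

lemma harmonic_rep_conv:
  assumes "harmonic_rep f\<^sub>1 h\<^sub>1 g\<^sub>1" and "harmonic_rep f\<^sub>2 h\<^sub>2 g\<^sub>2"
  shows "harmonic_rep (harmonic_conv f\<^sub>1 f\<^sub>2) (analytic_conv h\<^sub>1 h\<^sub>2) (analytic_conv g\<^sub>1 g\<^sub>2)"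
proof -
  have "fps_nth (fps_expansion g\<^sub>1 0) 0 = 0"
    using assms by (simp add: harmonic_rep_def fps_expansion_def)
  moreover have "analytic_conv g\<^sub>1 g\<^sub>2 0 = fps_nth (fps_expansion (analytic_conv g\<^sub>1 g\<^sub>2) 0) 0"
    by (simp add: fps_expansion_def)
  ultimately have "analytic_conv g\<^sub>1 g\<^sub>2 0 = 0"
    using assms by (simp add: harmonic_rep_def fps_nth_analytic_conv)
  then show ?thesis
    using assms harmonic_conv_eq[OF assms]
    by (simp add: harmonic_rep_def holomorphic_analytic_conv)
qed

lemma harmonic0_rep_conv:
  assumes "harmonic0_rep f\<^sub>1 h\<^sub>1 g\<^sub>1" and "harmonic0_rep f\<^sub>2 h\<^sub>2 g\<^sub>2"
  shows "harmonic0_rep (harmonic_conv f\<^sub>1 f\<^sub>2) (analytic_conv h\<^sub>1 h\<^sub>2) (analytic_conv g\<^sub>1 g\<^sub>2)"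
proof -
  have "h\<^sub>1 holomorphic_on unit_disc" "h\<^sub>2 holomorphic_on unit_disc"
    "g\<^sub>1 holomorphic_on unit_disc" "g\<^sub>2 holomorphic_on unit_disc"
    using assms by (auto simp: harmonic0_rep_def harmonic_rep_def)
  then show ?thesis
    using assms harmonic_rep_conv by (simp add: harmonic0_rep_def fps_nth_analytic_conv)
qed

section \<open>Coefficient estimates and closure under convolution\<close>

text \<open>This is Parseval's inequality for the two functions h - z h' and g - z g', whose norms
  add up to less than \<open>lam\<close> on the disc.\<close>

lemma Omega_coeff_bound:
  assumes "harmonic0_rep f h g"
    and "\<And>z. z \<in> unit_disc \<Longrightarrow> norm (h z - z * deriv h z) < lam - norm (g z - z * deriv g z)"
  shows "(\<Sum>n<m. (real n - 1)\<^sup>2 * ((norm (fps_nth (fps_expansion h 0) n))\<^sup>2 +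
                  (norm (fps_nth (fps_expansion g 0) n))\<^sup>2)) \<le> lam\<^sup>2"
proof -
  have hol: "h holomorphic_on unit_disc" "g holomorphic_on unit_disc"
    using assms(1) by (auto simp: harmonic0_rep_def harmonic_rep_def)
  have "norm (h z - z * deriv h z) + norm (g z - z * deriv g z) \<le> lam" if "z \<in> unit_disc" for z
    using assms(2)[OF that] by simp
  note parseval_bound_disc[OF holomorphic_defect[OF hol(1)] holomorphic_defect[OF hol(2)] this, of m]
  moreover have "(norm (1 - of_nat n :: complex))\<^sup>2 = (real n - 1)\<^sup>2" for n
    by (metis norm_of_real of_real_1 of_real_diff of_real_of_nat_eq power2_abs power2_commute)
  ultimately show ?thesis
    by (simp add: fps_nth_defect hol norm_mult power_mult_distrib distrib_left)
qed

text \<open>With \<open>k = n - 1\<close>, combine k \<le> k^2, the AM-GM inequality and |z|^n \<le>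
  |z|. The last one fails at \<open>n = 0\<close> for |z| < 1, where the vanishing constant
  coefficient takes over. The factor \<open>norm z\<close> is kept outside to yield strictness
  later.\<close>

lemma defect_conv_term_bound:
  fixes a a' z :: complex
  assumes "norm z \<le> 1" and "n = 0 \<Longrightarrow> a = 0"
  shows "norm ((1 - of_nat n) * (a * a') * z ^ n) \<le>
    norm z * ((real n - 1)\<^sup>2 * ((norm a)\<^sup>2 + (norm a')\<^sup>2) / 2)"
proof (cases n)
  case (Suc k)
  have le: "real k * (norm a * norm a') \<le> (real k)\<^sup>2 * (((norm a)\<^sup>2 + (norm a')\<^sup>2) / 2)"
  proof (rule mult_mono)
    show "real k \<le> (real k)\<^sup>2"
      by (cases k) (auto simp: power2_eq_square)
    show "norm a * norm a' \<le> ((norm a)\<^sup>2 + (norm a')\<^sup>2) / 2"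
      using sum_squares_bound[of "norm a" "norm a'"] by simp
  qed auto
  have "norm z ^ n \<le> norm z"
    using assms(1) Suc by (simp add: mult_left_le power_le_one)
  then have "norm z ^ n * (real k * (norm a * norm a')) \<le>
      norm z * ((real k)\<^sup>2 * (((norm a)\<^sup>2 + (norm a')\<^sup>2) / 2))"
    using le by (rule mult_mono) auto
  then show ?thesis
    using Suc by (simp add: norm_mult norm_power mult_ac)
qed (use assms in simp)

theorem corollary2p6:
  fixes lam :: real and f\<^sub>1 f\<^sub>2 :: "complex \<Rightarrow> complex"
  assumes "0 < lam" and "lam \<le> 1"
    and "f\<^sub>1 \<in> Omega_harmonic0 lam" and "f\<^sub>2 \<in> Omega_harmonic0 lam"
  shows "harmonic_conv f\<^sub>1 f\<^sub>2 \<in> Omega_harmonic0 lam"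
proof -
  obtain h\<^sub>1 g\<^sub>1 where rep1: "harmonic0_rep f\<^sub>1 h\<^sub>1 g\<^sub>1" and 1: "\<And>z. z \<in> unit_disc \<Longrightarrow>
      norm (h\<^sub>1 z - z * deriv h\<^sub>1 z) < lam - norm (g\<^sub>1 z - z * deriv g\<^sub>1 z)"
    using assms(3) by (auto simp: Omega_harmonic0_def)
  obtain h\<^sub>2 g\<^sub>2 where rep2: "harmonic0_rep f\<^sub>2 h\<^sub>2 g\<^sub>2" and 2: "\<And>z. z \<in> unit_disc \<Longrightarrow>
      norm (h\<^sub>2 z - z * deriv h\<^sub>2 z) < lam - norm (g\<^sub>2 z - z * deriv g\<^sub>2 z)"
    using assms(4) by (auto simp: Omega_harmonic0_def)
  define h g where "h = analytic_conv h\<^sub>1 h\<^sub>2" and "g = analytic_conv g\<^sub>1 g\<^sub>2"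
  define a\<^sub>1 a\<^sub>2 b\<^sub>1 b\<^sub>2 where coeff: "a\<^sub>1 = fps_nth (fps_expansion h\<^sub>1 0)"
    "a\<^sub>2 = fps_nth (fps_expansion h\<^sub>2 0)" "b\<^sub>1 = fps_nth (fps_expansion g\<^sub>1 0)"
    "b\<^sub>2 = fps_nth (fps_expansion g\<^sub>2 0)"
  have hol: "h\<^sub>1 holomorphic_on unit_disc" "h\<^sub>2 holomorphic_on unit_disc"
    "g\<^sub>1 holomorphic_on unit_disc" "g\<^sub>2 holomorphic_on unit_disc"
    using rep1 rep2 by (auto simp: harmonic0_rep_def harmonic_rep_def)
  have rep: "harmonic0_rep (harmonic_conv f\<^sub>1 f\<^sub>2) h g"
    unfolding h_def g_def using rep1 rep2 by (rule harmonic0_rep_conv)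
  have "norm (h z - z * deriv h z) < lam - norm (g z - z * deriv g z)"
    if z: "z \<in> unit_disc" for z
  proof -
    have sums: "(\<lambda>n. (1 - of_nat n) * (a\<^sub>1 n * a\<^sub>2 n) * z ^ n) sums (h z - z * deriv h z)"
      "(\<lambda>n. (1 - of_nat n) * (b\<^sub>1 n * b\<^sub>2 n) * z ^ n) sums (g z - z * deriv g z)"
      using fps_expansion_sums_disc[OF holomorphic_defect z, of h]
        fps_expansion_sums_disc[OF holomorphic_defect z, of g]
      by (simp_all add: h_def g_def coeff hol fps_nth_defect fps_nth_analytic_conv
          holomorphic_analytic_conv)
    \<comment> \<open>\<open>U\<close> and \<open>V\<close> are the summands of the coefficient
      bounds for \<open>f\<^sub>1\<close> and \<open>f\<^sub>2\<close>; all their partial sums are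
      at most \<open>lam\<^sup>2\<close>.\<close>
    define U where "U = (\<lambda>n. (real n - 1)\<^sup>2 * ((norm (a\<^sub>1 n))\<^sup>2 + (norm (b\<^sub>1 n))\<^sup>2))"
    define V where "V = (\<lambda>n. (real n - 1)\<^sup>2 * ((norm (a\<^sub>2 n))\<^sup>2 + (norm (b\<^sub>2 n))\<^sup>2))"
    have zero: "a\<^sub>1 0 = 0" "b\<^sub>1 0 = 0"
      using rep1 by (auto simp: harmonic0_rep_def coeff)
    have partial: "norm (\<Sum>n<m. (1 - of_nat n) * (a\<^sub>1 n * a\<^sub>2 n) * z ^ n) +
        norm (\<Sum>n<m. (1 - of_nat n) * (b\<^sub>1 n * b\<^sub>2 n) * z ^ n) \<le> norm z * lam\<^sup>2" for m
    proof -
      \<comment> \<open>AM-GM pairs \<open>a\<^sub>1\<close> with \<open>a\<^sub>2\<close> and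
        \<open>b\<^sub>1\<close> with \<open>b\<^sub>2\<close>; regrouping by function instead gives
        the average of \<open>U\<close> and \<open>V\<close>.\<close>
      have "norm ((1 - of_nat n) * (a\<^sub>1 n * a\<^sub>2 n) * z ^ n) +
          norm ((1 - of_nat n) * (b\<^sub>1 n * b\<^sub>2 n) * z ^ n) \<le> norm z * ((U n + V n) / 2)" for n
        using defect_conv_term_bound[of z n "a\<^sub>1 n" "a\<^sub>2 n"]
          defect_conv_term_bound[of z n "b\<^sub>1 n" "b\<^sub>2 n"] z zero
        by (auto simp: U_def V_def field_simps)
      then have "(\<Sum>n<m. norm ((1 - of_nat n) * (a\<^sub>1 n * a\<^sub>2 n) * z ^ n) +
          norm ((1 - of_nat n) * (b\<^sub>1 n * b\<^sub>2 n) * z ^ n)) \<le> (\<Sum>n<m. norm z * ((U n + V n) / 2))"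
        by (intro sum_mono)
      also have "\<dots> = norm z * ((sum U {..<m} + sum V {..<m}) / 2)"
        by (simp add: sum.distrib flip: sum_distrib_left sum_divide_distrib)
      also have "\<dots> \<le> norm z * lam\<^sup>2"
        using Omega_coeff_bound[OF rep1 1, of m] Omega_coeff_bound[OF rep2 2, of m]
        by (intro mult_left_mono) (simp_all add: U_def V_def coeff)
      finally show ?thesis
        using norm_sum[of "\<lambda>n. (1 - of_nat n) * (a\<^sub>1 n * a\<^sub>2 n) * z ^ n" "{..<m}"]
          norm_sum[of "\<lambda>n. (1 - of_nat n) * (b\<^sub>1 n * b\<^sub>2 n) * z ^ n" "{..<m}"]
        by (simp add: sum.distrib)
    qed
    \<comment> \<open>Let \<open>m\<close> tend to infinity in \<open>partial\<close>. The limit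
      only preserves \<le>; the strict inequality comes from |z| < 1 at the end, after
      \<open>lam \<le> 1\<close> has given \<open>lam\<^sup>2 \<le> lam\<close>.\<close>
    have "norm (h z - z * deriv h z) + norm (g z - z * deriv g z) \<le> norm z * lam\<^sup>2"
      by (rule LIMSEQ_le_const2[OF tendsto_add[OF
            sums(1)[unfolded sums_def, THEN tendsto_norm] sums(2)[unfolded sums_def, THEN tendsto_norm]]])
        (use partial in auto)
    also have "\<dots> \<le> norm z * lam"
      using assms(1,2) by (intro mult_left_mono) (auto simp: power2_eq_square mult_left_le)
    also have "\<dots> < lam"
      using z assms(1) by simp
    finally show ?thesis by simp
  qed
  with rep show ?thesis
    unfolding Omega_harmonic0_def harmonic0_def by blast
qed

end
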